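(* Let $(R,\mathfrak m)$ be a local noetherian domain, $I=(f_1,\ldots,f_n)\subseteq\mathfrak m$ an ideal with $I\neq 0$, $f\in\mathfrak m$, and let $A=R[T_1,\ldots,T_n]/(f_1T_1+\cdots+f_nT_n+f)$ be the forcing algebra for these data. Let $H=V(\mathfrak p)$ be the horizontal component of $\operatorname{Spec} A$. Then $\operatorname{Spec} A$ is connected if and only if $\mathfrak p+(I,f)\neq(1)$ in $R[T_1,\ldots,T_n]$.
   Context: The empty topological space is not considered connected. For a noetherian domain $R$ and $I\neq 0$, the horizontal component of $\operatorname{Spec} A$ is the unique irreducible component whose image in $\operatorname{Spec} R$ is dense; it is given by the prime ideal $\mathfrak p=R[T_1,\ldots,T_n]\cap (f_1T_1+\cdots+f_nT_n+f)\,Q(R)[T_1,\ldots,T_n]$ of $R[T_1,\ldots,T_n]$, where $Q(R)$ is the quotient field of $R$. Here $(I,f)$ denotes the ideal of $R[T_1,\ldots,T_n]$ generated by $f_1,\ldots,f_n,f$. *)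

theory Defs
  imports
    "HOL-Analysis.Abstract_Topology"
    "HOL-Algebra.Ring_Divisibility"
    "HOL-Algebra.QuotRing"
    "HOL-Algebra.Algebraic_Closure_Type"
    "HOL-Computational_Algebra.Polynomial_Factorial"
    "HOL-Library.Poly_Mapping"
begin

subsection \<open>The prime spectrum\<close>

definition prime_spectrum :: "('a, 'b) ring_scheme \<Rightarrow> 'a set set" where
  "prime_spectrum R = {P. primeideal P R}"

definition vanishing_locus :: "('a, 'b) ring_scheme \<Rightarrow> 'a set \<Rightarrow> 'a set set" where
  "vanishing_locus R S = {P \<in> prime_spectrum R. S \<subseteq> P}"

definition zariski_topology :: "('a, 'b) ring_scheme \<Rightarrow> 'a set topology" where
  "zariski_topology R =
     topology (\<lambda>U. \<exists>S \<subseteq> carrier R. U = prime_spectrum R - vanishing_locus R S)"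

lemma vanishing_locus_Un:
  assumes "S \<subseteq> carrier R" "T \<subseteq> carrier R"
  shows "vanishing_locus R S \<union> vanishing_locus R T =
         vanishing_locus R {s \<otimes>\<^bsub>R\<^esub> t | s t. s \<in> S \<and> t \<in> T}"
proof (rule Set.set_eqI)
  fix P
  show "P \<in> vanishing_locus R S \<union> vanishing_locus R T \<longleftrightarrow>
        P \<in> vanishing_locus R {s \<otimes>\<^bsub>R\<^esub> t | s t. s \<in> S \<and> t \<in> T}"
  proof (cases "primeideal P R")
    case True
    then interpret primeideal P R .
    have "S \<subseteq> P \<or> T \<subseteq> P \<longleftrightarrow> {s \<otimes>\<^bsub>R\<^esub> t | s t. s \<in> S \<and> t \<in> T} \<subseteq> P"
    proof
      assume "S \<subseteq> P \<or> T \<subseteq> P"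
      then show "{s \<otimes>\<^bsub>R\<^esub> t | s t. s \<in> S \<and> t \<in> T} \<subseteq> P"
        using assms by (auto intro: I_l_closed I_r_closed)
    next
      assume "{s \<otimes>\<^bsub>R\<^esub> t | s t. s \<in> S \<and> t \<in> T} \<subseteq> P"
      then have *: "s \<otimes>\<^bsub>R\<^esub> t \<in> P" if "s \<in> S" "t \<in> T" for s t
        using that by blast
      show "S \<subseteq> P \<or> T \<subseteq> P"
      proof (rule ccontr)
        assume "\<not> (S \<subseteq> P \<or> T \<subseteq> P)"
        then obtain s t where st: "s \<in> S" "s \<notin> P" "t \<in> T" "t \<notin> P"
          by auto
        then have "s \<in> carrier R" "t \<in> carrier R"
          using assms by auto
        from I_prime[OF this *[OF st(1,3)]] st show False
          by auto
      qed
    qed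
    with True show ?thesis
      by (simp add: vanishing_locus_def prime_spectrum_def)
  qed (simp add: vanishing_locus_def prime_spectrum_def)
qed

lemma istopology_zariski:
  "istopology (\<lambda>U. \<exists>S \<subseteq> carrier R. U = prime_spectrum R - vanishing_locus R S)"
    (is "istopology ?op")
  unfolding istopology_def
proof (intro conjI allI impI)
  fix U V assume "?op U" "?op V"
  then obtain S T where ST: "S \<subseteq> carrier R" "U = prime_spectrum R - vanishing_locus R S"
    "T \<subseteq> carrier R" "V = prime_spectrum R - vanishing_locus R T"
    by blast
  let ?ST = "{s \<otimes>\<^bsub>R\<^esub> t | s t. s \<in> S \<and> t \<in> T}"
  show "?op (U \<inter> V)"
  proof (cases "prime_spectrum R = {}")
    case True
    with ST show ?thesis by blast
  next
    case False
    then obtain P where "primeideal P R" by (auto simp: prime_spectrum_def)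
    then interpret primeideal P R .
    have "U \<inter> V = prime_spectrum R - (vanishing_locus R S \<union> vanishing_locus R T)"
      using ST by blast
    also have "\<dots> = prime_spectrum R - vanishing_locus R ?ST"
      by (simp only: vanishing_locus_Un[OF ST(1,3)])
    finally have eq: "U \<inter> V = prime_spectrum R - vanishing_locus R ?ST" .
    have "?ST \<subseteq> carrier R"
      using ST(1,3) by auto
    then show ?thesis
      using eq by (intro exI[of _ ?ST] conjI)
  qed
next
  fix \<K> assume *: "\<forall>U\<in>\<K>. ?op U"
  let ?S = "\<Union>{S. S \<subseteq> carrier R \<and> prime_spectrum R - vanishing_locus R S \<in> \<K>}"
  have "\<Union>\<K> = prime_spectrum R - vanishing_locus R ?S"
  proof
    show "\<Union>\<K> \<subseteq> prime_spectrum R - vanishing_locus R ?S"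
    proof
      fix P assume "P \<in> \<Union>\<K>"
      then obtain U where U: "U \<in> \<K>" "P \<in> U"
        by auto
      with * obtain S where S: "S \<subseteq> carrier R" "U = prime_spectrum R - vanishing_locus R S"
        by auto
      with U have "S \<subseteq> ?S" by auto
      have "P \<in> prime_spectrum R" "\<not> S \<subseteq> P"
        using U S by (auto simp: vanishing_locus_def)
      with \<open>S \<subseteq> ?S\<close> have "\<not> ?S \<subseteq> P"
        using order_trans by metis
      with \<open>P \<in> prime_spectrum R\<close> show "P \<in> prime_spectrum R - vanishing_locus R ?S"
        by (simp add: vanishing_locus_def)
    qed
    show "prime_spectrum R - vanishing_locus R ?S \<subseteq> \<Union>\<K>"
    proof
      fix P assume P: "P \<in> prime_spectrum R - vanishing_locus R ?S"
      then have "\<not> ?S \<subseteq> P"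
        by (simp add: vanishing_locus_def)
      then obtain S where S: "prime_spectrum R - vanishing_locus R S \<in> \<K>" "\<not> S \<subseteq> P"
        by auto
      with P have "P \<in> prime_spectrum R - vanishing_locus R S"
        by (simp add: vanishing_locus_def)
      with S show "P \<in> \<Union>\<K>"
        by auto
    qed
  qed
  moreover have "?S \<subseteq> carrier R" by blast
  ultimately show "?op (\<Union>\<K>)" by (intro exI[of _ ?S] conjI)
qed

lemma openin_zariski:
  "openin (zariski_topology R) U \<longleftrightarrow>
     (\<exists>S \<subseteq> carrier R. U = prime_spectrum R - vanishing_locus R S)"
  unfolding zariski_topology_def by (simp add: topology_inverse'[OF istopology_zariski])

lemma topspace_zariski: "topspace (zariski_topology R) = prime_spectrum R"
proof
  show "topspace (zariski_topology R) \<subseteq> prime_spectrum R"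
    unfolding topspace_def openin_zariski by blast
  have "prime_spectrum R = prime_spectrum R - vanishing_locus R (carrier R)"
  proof -
    have "\<not> carrier R \<subseteq> P" if "primeideal P R" for P
      using primeideal.I_notcarr[OF that] ideal.Icarr[OF primeideal.axioms(1)[OF that]]
      by auto
    then show ?thesis
      by (auto simp: vanishing_locus_def prime_spectrum_def)
  qed
  then have "openin (zariski_topology R) (prime_spectrum R)"
    unfolding openin_zariski by (intro exI[of _ "carrier R"] conjI subset_refl)
  then show "prime_spectrum R \<subseteq> topspace (zariski_topology R)"
    by (rule openin_subset)
qed

text \<open>
  The empty space counts as \<^const>\<open>connected_space\<close>, but here it is not considered connected;
  so the spectrum of the zero ring is not connected.
\<close>

definition spectrum_connected :: "('a, 'b) ring_scheme \<Rightarrow> bool" where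
  "spectrum_connected R \<longleftrightarrow>
     topspace (zariski_topology R) \<noteq> {} \<and> connected_space (zariski_topology R)"

subsection \<open>Local rings\<close>

definition local_ring :: "('a, 'b) ring_scheme \<Rightarrow> 'a set \<Rightarrow> bool" where
  "local_ring R \<mm> \<longleftrightarrow> cring R \<and> maximalideal \<mm> R \<and> (\<forall>M. maximalideal M R \<longrightarrow> M = \<mm>)"

subsection \<open>Forcing algebras\<close>

text \<open>
  Polynomials over \<^typ>\<open>'a\<close> in the variables \<open>T\<^sub>i\<close>, with \<open>i\<close> ranging over the index type \<^typ>\<open>'n\<close>:
  finitely supported maps from exponent vectors to coefficients, with the convolution product
  as multiplication.
\<close>

type_synonym ('n, 'a) mpolynomial = "('n \<Rightarrow>\<^sub>0 nat) \<Rightarrow>\<^sub>0 'a"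

definition mconst :: "'a::zero \<Rightarrow> ('n, 'a) mpolynomial" where
  "mconst c = Poly_Mapping.single 0 c"

definition mvar :: "'n \<Rightarrow> ('n, 'a::zero_neq_one) mpolynomial" where
  "mvar i = Poly_Mapping.single (Poly_Mapping.single i 1) 1"

definition forcing_poly :: "('n::finite \<Rightarrow> 'a::comm_ring_1) \<Rightarrow> 'a \<Rightarrow> ('n, 'a) mpolynomial" where
  "forcing_poly f g = (\<Sum>i\<in>UNIV. mconst (f i) * mvar i) + mconst g"

definition forcing_algebra ::
    "('n::finite \<Rightarrow> 'a::comm_ring_1) \<Rightarrow> 'a \<Rightarrow> ('n, 'a) mpolynomial set ring" where
  "forcing_algebra f g =
     ring_of_type_algebra Quot (PIdl\<^bsub>ring_of_type_algebra\<^esub> (forcing_poly f g))"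

definition to_fract_mpoly :: "('n, 'a::idom) mpolynomial \<Rightarrow> ('n, 'a fract) mpolynomial" where
  "to_fract_mpoly = Poly_Mapping.map to_fract"

text \<open>
  The prime ideal of the polynomial ring over \<open>R\<close> that cuts out the horizontal component of the
  spectrum of the forcing algebra: the contraction of the principal ideal which the forcing
  polynomial generates over the quotient field of \<open>R\<close>.
\<close>

definition horizontal_ideal ::
    "('n::finite \<Rightarrow> 'a::idom) \<Rightarrow> 'a \<Rightarrow> ('n, 'a) mpolynomial set" where
  "horizontal_ideal f g =
     {p. to_fract_mpoly p \<in> PIdl\<^bsub>ring_of_type_algebra\<^esub> (to_fract_mpoly (forcing_poly f g))}"

end

theory Submission
  imports Defs
begin

text \<open>
  Write \<open>h = f\<^sub>1T\<^sub>1 + \<dots> + f\<^sub>nT\<^sub>n + g\<close>, \<open>P = R[T\<^sub>1, \<dots>, T\<^sub>n]\<close>, let \<open>\<pp>\<close> be the horizontal prime and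
  \<open>I = (f\<^sub>1, \<dots>, f\<^sub>n)\<close>. The spectrum of the forcing algebra is the closed subspace \<open>V(h)\<close> of
  \<open>Spec P\<close> (\<open>spectrum_connected_Quot_iff\<close>), and it is the union of two closed pieces,
  \<open>V(h) = V(\<pp>) \<union> V((I, g)P)\<close> (\<open>forcing_locus_decomposition\<close>): over the points where some \<open>f\<^sub>i\<close> does
  not vanish, the equation \<open>h = 0\<close> can be solved for \<open>T\<^sub>i\<close> and only the horizontal component is seen;
  where all \<open>f\<^sub>i\<close> vanish, the equation reads \<open>g = 0\<close>.

  Both pieces are nonempty and connected. The first is irreducible, because \<open>\<pp>\<close> is prime
  (\<open>primeideal_horizontal\<close>). The second is an affine space over the closed subset \<open>V(I, g)\<close> of
  \<open>Spec R\<close>; since \<open>R\<close> is local, every point of that subset specializes to the closed point \<open>\<mm>\<close>,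
  so every irreducible closed subset of the form \<open>V(\<qq>P)\<close> contains \<open>\<mm>P\<close>
  (\<open>connectedin_locus_of_constants\<close>). A union of two nonempty connected closed sets is connected
  exactly when they meet, and \<open>V(\<pp>) \<inter> V((I, g)P) = V(\<pp> + (I, g)P)\<close> is nonempty exactly when
  \<open>\<pp> + (I, g)P\<close> is a proper ideal.

  The algebra behind the decomposition and the primality of \<open>\<pp>\<close> is division by \<open>h\<close>, regarded as a
  linear polynomial in a variable \<open>T\<^sub>i\<close> with \<open>f\<^sub>i \<noteq> 0\<close>: up to a power of \<open>f\<^sub>i\<close>, every polynomial is
  congruent modulo \<open>h\<close> to one that does not involve \<open>T\<^sub>i\<close> (\<open>forcing_pseudo_division\<close>), and no
  nonzero multiple of \<open>h\<close> is free of \<open>T\<^sub>i\<close> (\<open>free_of_forcing_multiple\<close>). Hence membership in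
  \<open>\<pp>\<close> is decided by whether the remainder vanishes.
\<close>

section \<open>Spectra and their closed subspaces\<close>

lemma (in cring) exists_maximalideal_above:
  assumes "ideal J R" "\<one> \<notin> J"
  obtains M where "maximalideal M R" "J \<subseteq> M"
proof -
  let ?A = "{K. ideal K R \<and> J \<subseteq> K \<and> \<one> \<notin> K}"
  have "\<exists>M\<in>?A. \<forall>L\<in>?A. M \<subseteq> L \<longrightarrow> L = M"
  proof (rule subset_Zorn_nonempty)
    show "?A \<noteq> {}" using assms by blast
    fix C assume C: "C \<noteq> {}" "subset.chain ?A C"
    then have "subset.chain {K. ideal K R} C"
      unfolding pred_on.chain_def by blast
    from chain_Union_is_ideal[OF this] C show "\<Union>C \<in> ?A"
      by (auto simp: pred_on.chain_def)
  qed
  then obtain M where M: "ideal M R" "J \<subseteq> M" "\<one> \<notin> M"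
    and max: "\<And>L. L \<in> ?A \<Longrightarrow> M \<subseteq> L \<Longrightarrow> L = M" by auto
  have "maximalideal M R"
  proof (rule maximalidealI[OF M(1)])
    show "carrier R \<noteq> M" using M(3) by auto
    fix K assume K: "ideal K R" "M \<subseteq> K" "K \<subseteq> carrier R"
    show "K = M \<or> K = carrier R"
    proof (cases "\<one> \<in> K")
      case True
      then show ?thesis using ideal.one_imp_carrier[OF K(1)] by simp
    next
      case False
      then show ?thesis using max[of K] K M by auto
    qed
  qed
  with M(2) that show ?thesis by blast
qed

lemma (in cring) vanishing_locus_nonempty_iff:
  assumes "ideal J R"
  shows "vanishing_locus R J \<noteq> {} \<longleftrightarrow> \<one> \<notin> J"
proof
  assume "vanishing_locus R J \<noteq> {}"
  then obtain Q where "primeideal Q R" "J \<subseteq> Q"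
    by (auto simp: vanishing_locus_def prime_spectrum_def)
  then show "\<one> \<notin> J"
    using ideal.one_imp_carrier[OF primeideal.axioms(1)] primeideal.I_notcarr by blast
next
  assume "\<one> \<notin> J"
  then obtain M where "maximalideal M R" "J \<subseteq> M"
    using exists_maximalideal_above[OF assms] by blast
  then show "vanishing_locus R J \<noteq> {}"
    using maximalideal_prime by (auto simp: vanishing_locus_def prime_spectrum_def)
qed

lemma closedin_zariski:
  "closedin (zariski_topology R) V \<longleftrightarrow> (\<exists>S \<subseteq> carrier R. V = vanishing_locus R S)"
proof -
  have "vanishing_locus R S \<subseteq> prime_spectrum R" for S
    by (auto simp: vanishing_locus_def)
  then show ?thesis
    unfolding closedin_def openin_zariski topspace_zariski
    by (metis Diff_Diff_Int Diff_subset inf.absorb_iff2)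
qed

lemma closedin_vanishing_locus:
  "S \<subseteq> carrier R \<Longrightarrow> closedin (zariski_topology R) (vanishing_locus R S)"
  by (auto simp: closedin_zariski)

lemma prime_spectrum_subset_carrier:
  "Q \<in> prime_spectrum R \<Longrightarrow> Q \<subseteq> carrier R"
  using ideal.Icarr primeideal.axioms(1) by (fastforce simp: prime_spectrum_def)

lemma zariski_closure_of_point:
  assumes "Q \<in> prime_spectrum R"
  shows "zariski_topology R closure_of {Q} = vanishing_locus R Q"
proof (rule closure_of_unique)
  show "{Q} \<subseteq> vanishing_locus R Q"
    using assms by (auto simp: vanishing_locus_def)
  show "closedin (zariski_topology R) (vanishing_locus R Q)"
    using prime_spectrum_subset_carrier[OF assms] by (auto simp: closedin_zariski)
  show "vanishing_locus R Q \<subseteq> T" if "{Q} \<subseteq> T" "closedin (zariski_topology R) T" for T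
    using that by (auto simp: closedin_zariski vanishing_locus_def)
qed

text \<open>
  Irreducible closed sets are connected, being closures of points.
\<close>

lemma connectedin_vanishing_locus_prime:
  assumes "Q \<in> prime_spectrum R"
  shows "connectedin (zariski_topology R) (vanishing_locus R Q)"
proof -
  have "connectedin (zariski_topology R) {Q}"
    using assms by (simp add: topspace_zariski)
  from connectedin_closure_of[OF this] show ?thesis
    by (simp only: zariski_closure_of_point[OF assms])
qed

text \<open>
  One half of the correspondence between the primes of a quotient and the primes above the kernel:
  if \<open>h x = h q\<close> with \<open>q \<in> Q\<close>, then \<open>x\<close> and \<open>q\<close> differ by an element of the kernel, so \<open>x \<in> Q\<close>.
  Thus \<open>h x \<in> h ` Q\<close> can be tested on any representative, and primality passes to the image.
\<close>

lemma (in ring_hom_ring) surj_image_primeideal: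
  assumes R: "cring R" and S: "cring S" and surj: "h ` carrier R = carrier S"
    and Q: "primeideal Q R" and ker: "a_kernel R S h \<subseteq> Q"
  shows "primeideal (h ` Q) S" "{x \<in> carrier R. h x \<in> h ` Q} = Q"
proof -
  interpret Q: primeideal Q R by fact
  have mem: "x \<in> Q" if x: "x \<in> carrier R" and hx: "h x \<in> h ` Q" for x
  proof -
    from hx obtain q where q: "q \<in> Q" and eq: "h x = h q" by blast
    note qR = Q.Icarr[OF q]
    have "h (x \<ominus> q) = \<zero>\<^bsub>S\<^esub>"
      unfolding R.minus_eq using x qR by (simp add: eq S.r_neg)
    then have "x \<ominus> q \<in> Q"
      using ker x qR unfolding a_kernel_def' by blast
    then have "(x \<ominus> q) \<oplus> q \<in> Q" using q by (rule Q.a_closed)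
    moreover have "(x \<ominus> q) \<oplus> q = x"
      using x qR by (simp add: R.minus_eq R.a_assoc R.l_neg)
    ultimately show "x \<in> Q" by simp
  qed
  show "{x \<in> carrier R. h x \<in> h ` Q} = Q"
    using mem Q.Icarr by blast
  show "primeideal (h ` Q) S"
  proof (rule primeidealI)
    show "ideal (h ` Q) S"
    proof (rule idealI)
      show "ring S" by (rule S.ring_axioms)
      show "subgroup (h ` Q) (add_monoid S)"
        using group_hom.subgroup_img_is_subgroup[OF a_group_hom Q.a_subgroup] by simp
      fix a x assume "a \<in> h ` Q" and x: "x \<in> carrier S"
      then obtain q where q: "q \<in> Q" "a = h q" by blast
      obtain y where y: "y \<in> carrier R" "x = h y" using x surj by blast
      have "x \<otimes>\<^bsub>S\<^esub> a = h (y \<otimes> q)" "a \<otimes>\<^bsub>S\<^esub> x = h (q \<otimes> y)"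
        using q y Q.Icarr[OF q(1)] by simp_all
      then show "x \<otimes>\<^bsub>S\<^esub> a \<in> h ` Q" "a \<otimes>\<^bsub>S\<^esub> x \<in> h ` Q"
        using Q.I_l_closed[OF q(1) y(1)] Q.I_r_closed[OF q(1) y(1)] by blast+
    qed
    show "cring S" by fact
    show "carrier S \<noteq> h ` Q"
    proof
      assume "carrier S = h ` Q"
      then have "carrier R \<subseteq> Q" using mem hom_closed by blast
      then show False using Q.I_notcarr Q.Icarr by blast
    qed
    fix a b assume "a \<in> carrier S" "b \<in> carrier S" and ab: "a \<otimes>\<^bsub>S\<^esub> b \<in> h ` Q"
    then obtain x y where xy: "x \<in> carrier R" "a = h x" "y \<in> carrier R" "b = h y"
      using surj by (metis imageE)
    with ab have "h (x \<otimes> y) \<in> h ` Q" by simp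
    with xy have "x \<otimes> y \<in> Q" by (intro mem) simp_all
    with xy have "x \<in> Q \<or> y \<in> Q" using Q.I_prime by blast
    then show "a \<in> h ` Q \<or> b \<in> h ` Q" using xy by blast
  qed
qed

text \<open>
  Preimage under \<open>h\<close> and image under \<open>h\<close> are mutually inverse on the primes above the kernel. The
  preimage map is continuous for any homomorphism, and closed because a subset \<open>T\<close> of \<open>S\<close> is the
  image of its own preimage, so that \<open>V(T)\<close> corresponds to \<open>V(h\<^bsup>-1\<^esup> T)\<close>.
\<close>

lemma (in ring_hom_ring) homeomorphic_map_spectrum_surj:
  assumes R: "cring R" and S: "cring S" and surj: "h ` carrier R = carrier S"
  shows "homeomorphic_map (zariski_topology S)
           (subtopology (zariski_topology R) (vanishing_locus R (a_kernel R S h)))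
           (\<lambda>Q. {x \<in> carrier R. h x \<in> Q})"
proof -
  let ?K = "a_kernel R S h" and ?c = "\<lambda>Q. {x \<in> carrier R. h x \<in> Q}"
  have c: "?c Q \<in> prime_spectrum R" "?K \<subseteq> ?c Q" if "Q \<in> prime_spectrum S" for Q
  proof -
    from that have Q: "primeideal Q S" by (simp add: prime_spectrum_def)
    show "?c Q \<in> prime_spectrum R"
      using primeideal_vimage[OF R Q] unfolding prime_spectrum_def by blast
    have "\<zero>\<^bsub>S\<^esub> \<in> Q"
      using Q by (intro additive_subgroup.zero_closed ideal.axioms(1) primeideal.axioms(1))
    then show "?K \<subseteq> ?c Q"
      unfolding a_kernel_def' by (intro subsetI CollectI) simp
  qed
  have img: "h ` ?c Q = Q" if "Q \<in> prime_spectrum S" for Q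
    using prime_spectrum_subset_carrier[OF that] unfolding surj[symmetric] by blast
  have img_prime: "h ` q \<in> prime_spectrum S" "?c (h ` q) = q"
    if "q \<in> prime_spectrum R" "?K \<subseteq> q" for q
    using surj_image_primeideal[OF R S surj _ that(2)] that(1) unfolding prime_spectrum_def by blast+
  have top: "topspace (subtopology (zariski_topology R) (vanishing_locus R ?K)) =
      vanishing_locus R ?K"
    by (auto simp: topspace_zariski vanishing_locus_def)
  have onto: "?c ` prime_spectrum S = vanishing_locus R ?K"
  proof (intro Set.equalityI subsetI)
    fix q assume "q \<in> ?c ` prime_spectrum S"
    then show "q \<in> vanishing_locus R ?K"
      using c unfolding vanishing_locus_def by blast
  next
    fix q assume "q \<in> vanishing_locus R ?K"
    then show "q \<in> ?c ` prime_spectrum S"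
      using img_prime[of q] unfolding vanishing_locus_def by blast
  qed
  show ?thesis
  proof (rule bijective_closed_imp_homeomorphic_map)
    show "?c ` topspace (zariski_topology S) =
        topspace (subtopology (zariski_topology R) (vanishing_locus R ?K))"
      unfolding top topspace_zariski by (rule onto)
    show "inj_on ?c (topspace (zariski_topology S))"
      unfolding topspace_zariski by (rule inj_on_inverseI[where g = "(`) h"], rule img)
    show "continuous_map (zariski_topology S)
        (subtopology (zariski_topology R) (vanishing_locus R ?K)) ?c"
      unfolding continuous_map_in_subtopology
    proof (intro conjI)
      show "?c \<in> topspace (zariski_topology S) \<rightarrow> vanishing_locus R ?K"
        unfolding topspace_zariski onto[symmetric] by blast
      show "continuous_map (zariski_topology S) (zariski_topology R) ?c"
        unfolding continuous_map_closedin
      proof (intro conjI allI impI funcsetI ballI)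
        fix V assume "closedin (zariski_topology R) V"
        then obtain T where T: "T \<subseteq> carrier R" "V = vanishing_locus R T"
          by (auto simp: closedin_zariski)
        have "{Q \<in> topspace (zariski_topology S). ?c Q \<in> V} = vanishing_locus S (h ` T)"
          using c(1) T unfolding topspace_zariski vanishing_locus_def by blast
        moreover have "h ` T \<subseteq> carrier S"
          using T(1) unfolding surj[symmetric] by (rule image_mono)
        ultimately show "closedin (zariski_topology S)
            {Q \<in> topspace (zariski_topology S). ?c Q \<in> V}"
          unfolding closedin_zariski by (intro exI[of _ "h ` T"] conjI)
      qed (use c(1) in \<open>unfold topspace_zariski, blast\<close>)
    qed
    show "closed_map (zariski_topology S)
        (subtopology (zariski_topology R) (vanishing_locus R ?K)) ?c"
      unfolding closed_map_def
    proof (intro allI impI)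
      fix V assume "closedin (zariski_topology S) V"
      then obtain T where T: "T \<subseteq> carrier S" "V = vanishing_locus S T"
        by (auto simp: closedin_zariski)
      have "?c ` V = vanishing_locus R (?c T) \<inter> vanishing_locus R ?K"
      proof (intro Set.equalityI subsetI)
        fix q assume "q \<in> ?c ` V"
        then show "q \<in> vanishing_locus R (?c T) \<inter> vanishing_locus R ?K"
          using c unfolding T(2) vanishing_locus_def by blast
      next
        fix q assume q: "q \<in> vanishing_locus R (?c T) \<inter> vanishing_locus R ?K"
        then have "h ` ?c T \<subseteq> h ` q" unfolding vanishing_locus_def by blast
        moreover have "h ` ?c T = T" using T(1) unfolding surj[symmetric] by blast
        ultimately have "h ` q \<in> V"
          using q img_prime(1) unfolding T(2) vanishing_locus_def by simp
        moreover have "?c (h ` q) = q" using q img_prime(2) unfolding vanishing_locus_def by blast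
        ultimately show "q \<in> ?c ` V" by (rule image_eqI[rotated, OF _ sym])
      qed
      moreover have "closedin (zariski_topology R) (vanishing_locus R (?c T))"
        unfolding closedin_zariski by (intro exI[of _ "?c T"] conjI refl Collect_restrict)
      ultimately show "closedin (subtopology (zariski_topology R) (vanishing_locus R ?K)) (?c ` V)"
        unfolding closedin_subtopology by (intro exI[of _ "vanishing_locus R (?c T)"] conjI)
    qed
  qed
qed

lemma (in cring) spectrum_connected_Quot_iff:
  assumes J: "ideal J R"
  shows "spectrum_connected (R Quot J) \<longleftrightarrow>
         vanishing_locus R J \<noteq> {} \<and> connectedin (zariski_topology R) (vanishing_locus R J)"
proof -
  interpret J: ideal J R by fact
  interpret h: ring_hom_ring R "R Quot J" "(+>) J" by (rule J.rcos_ring_hom_ring)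
  have ker: "a_kernel R (R Quot J) ((+>) J) = J"
  proof (rule Set.set_eqI)
    fix x
    have "J +> x = J \<longleftrightarrow> x \<in> J" if "x \<in> carrier R"
      using J.a_rcos_self[OF that] J.a_rcos_const[of x] by blast
    then show "x \<in> a_kernel R (R Quot J) ((+>) J) \<longleftrightarrow> x \<in> J"
      using J.Icarr[of x] unfolding a_kernel_def' FactRing_def mem_Collect_eq ring.simps by blast
  qed
  have surj: "(+>) J ` carrier R = carrier (R Quot J)"
    unfolding FactRing_def A_RCOSETS_def' partial_object.simps by blast
  note homeo = h.homeomorphic_map_spectrum_surj[OF is_cring J.quotient_is_cring[OF is_cring] surj,
      unfolded ker]
  let ?Z = "zariski_topology R" and ?V = "vanishing_locus R J"
  have "zariski_topology (R Quot J) homeomorphic_space subtopology ?Z ?V"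
    using homeo by (rule homeomorphic_map_imp_homeomorphic_space)
  note homeo = homeomorphic_empty_space[OF this] homeomorphic_connected_space[OF this]
  have V: "topspace (subtopology ?Z ?V) = ?V"
    by (auto simp: topspace_zariski vanishing_locus_def)
  have "topspace (zariski_topology (R Quot J)) = {} \<longleftrightarrow> ?V = {}"
    using homeo(1) V by (metis null_topspace_iff_trivial)
  moreover have "connectedin ?Z ?V \<longleftrightarrow> connected_space (subtopology ?Z ?V)"
    unfolding connectedin_def topspace_zariski vanishing_locus_def by simp
  ultimately show ?thesis
    unfolding spectrum_connected_def using homeo(2) by simp
qed

section \<open>Prime ideals of polynomial rings\<close>

text \<open>
  The bridge between ideals of a ring given as a structure and plain calculations in a type class;
  closure under negation is multiplication by \<open>- 1\<close>.
\<close>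

lemma primeideal_type_iff:
  "primeideal Q (ring_of_type_algebra :: 'a::comm_ring_1 ring) \<longleftrightarrow>
     0 \<in> Q \<and> (\<forall>x\<in>Q. \<forall>y\<in>Q. x + y \<in> Q) \<and> (\<forall>r. \<forall>x\<in>Q. r * x \<in> Q) \<and> 1 \<notin> Q \<and>
     (\<forall>x y. x * y \<in> Q \<longrightarrow> x \<in> Q \<or> y \<in> Q)" (is "?L = ?R")
proof
  let ?A = "ring_of_type_algebra :: 'a ring"
  have ops: "carrier ?A = UNIV" "\<zero>\<^bsub>?A\<^esub> = 0" "\<one>\<^bsub>?A\<^esub> = 1"
    "x \<oplus>\<^bsub>?A\<^esub> y = x + y" "x \<otimes>\<^bsub>?A\<^esub> y = x * y" for x y
    by (simp_all add: ring_of_type_algebra_def)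
  have cring: "cring ?A" by (rule cring_from_type_algebra)
  then interpret A: cring ?A .
  {
    assume ?L
    then interpret Q: primeideal Q ?A .
    show ?R
    proof (intro conjI ballI allI impI)
      show "0 \<in> Q" using Q.zero_closed by (simp only: ops)
      show "x + y \<in> Q" if "x \<in> Q" "y \<in> Q" for x y
        using Q.a_closed[OF that] by (simp only: ops)
      show "r * x \<in> Q" if "x \<in> Q" for r x
        using Q.I_l_closed[OF that, of r] by (simp only: ops UNIV_I)
      show "1 \<notin> Q"
        using Q.one_imp_carrier Q.I_notcarr by (metis ops(3))
      show "x \<in> Q \<or> y \<in> Q" if "x * y \<in> Q" for x y
        using Q.I_prime[of x y] that by (simp only: ops UNIV_I)
    qed
  }
  assume R: ?R
  show ?L
  proof (rule primeidealI[OF _ cring])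
    have neg: "inv\<^bsub>add_monoid ?A\<^esub> x = - x" for x
      using A.minus_equality[of "- x" x] by (simp add: ops a_inv_def)
    have "- x \<in> Q" if "x \<in> Q" for x
      using R that by (metis mult_minus1)
    then have "subgroup Q (add_monoid ?A)"
      using R by (intro subgroup.intro) (simp_all add: neg[simplified], simp_all add: ops)
    moreover have "x * r \<in> Q" if "x \<in> Q" for r x
      using R that by (metis mult.commute)
    ultimately show "ideal Q ?A"
      using R by (intro idealI[OF A.ring_axioms]) (simp_all add: ops)
    show "carrier ?A \<noteq> Q" using R by (auto simp: ops)
  qed (use R in \<open>simp only: ops\<close>)
qed

lemma update_eq_add_single:
  assumes "a \<notin> Poly_Mapping.keys p"
  shows "Poly_Mapping.update a b p = p + Poly_Mapping.single a b"
  using assms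
  by (intro poly_mapping_eqI)
    (auto simp: lookup_update lookup_add lookup_single in_keys_iff when_def)

text \<open>
  A polynomial ring is generated as a ring by its constants and variables. Properties closed under
  sums and products can therefore be checked on generators, with no reference to exponent vectors.
\<close>

lemma mpolynomial_induct [case_names const var add mult]:
  fixes p :: "('n, 'a::comm_ring_1) mpolynomial"
  assumes const: "\<And>c. S (mconst c)"
    and var: "\<And>i. S (mvar i)"
    and add: "\<And>p q. S p \<Longrightarrow> S q \<Longrightarrow> S (p + q)"
    and mult: "\<And>p q. S p \<Longrightarrow> S q \<Longrightarrow> S (p * q)"
  shows "S p"
proof -
  have split: "Poly_Mapping.single (a + b) c = Poly_Mapping.single a c * Poly_Mapping.single b 1"
    for a b :: "'n \<Rightarrow>\<^sub>0 nat" and c :: 'a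
    by (simp add: mult_single)
  have power: "S (Poly_Mapping.single (Poly_Mapping.single i k) 1)" for i k
  proof (induction k)
    case 0
    then show ?case using const[of 1] by (simp add: mconst_def)
  next
    case (Suc k)
    have "Poly_Mapping.single i (Suc k) = Poly_Mapping.single i k + Poly_Mapping.single i 1"
      by (simp flip: single_add)
    with Suc show ?case
      using mult[OF Suc var[of i]] by (simp add: split mvar_def del: One_nat_def)
  qed
  have monomial: "S (Poly_Mapping.single e c)" for e c
  proof (induction e rule: update_induct)
    case const
    then show ?case using assms(1)[of c] by (simp add: mconst_def)
  next
    case (update e a b)
    then show ?case
      using mult[OF update(3) power[of a b]] by (simp add: update_eq_add_single split)
  qed
  show ?thesis
  proof (induction p rule: update_induct)
    case const
    then show ?case using monomial[of 0 0] by simp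
  next
    case (update p a b)
    then show ?case
      using add[OF update(3) monomial[of a b]] by (simp add: update_eq_add_single)
  qed
qed

lemma lookup_mult_sum:
  fixes x y :: "'b::comm_monoid_add \<Rightarrow>\<^sub>0 'a::comm_semiring_1"
  shows "Poly_Mapping.lookup (x * y) k =
    (\<Sum>(s, t)\<in>Poly_Mapping.keys x \<times> Poly_Mapping.keys y.
       Poly_Mapping.lookup x s * Poly_Mapping.lookup y t when k = s + t)"
proof -
  have inner: "(\<Sum>t. Poly_Mapping.lookup y t when k = s + t) =
      (\<Sum>t\<in>Poly_Mapping.keys y. Poly_Mapping.lookup y t when k = s + t)" for s
    by (rule Sum_any.expand_superset) (auto simp: in_keys_iff)
  have "Poly_Mapping.lookup (x * y) k = (\<Sum>s\<in>Poly_Mapping.keys x.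
      Poly_Mapping.lookup x s * (\<Sum>t\<in>Poly_Mapping.keys y. Poly_Mapping.lookup y t when k = s + t))"
    unfolding lookup_mult inner
    by (rule Sum_any.expand_superset) (auto simp: in_keys_iff)
  then show ?thesis
    by (simp add: sum_distrib_left mult_when sum.cartesian_product)
qed

lemma mconst_mult: "mconst (a * b) = mconst a * mconst b"
  by (simp add: mconst_def mult_single)

lemma mconst_add: "mconst (a + b) = mconst a + mconst b"
  by (simp add: mconst_def single_add)

lemma mconst_0 [simp]: "mconst 0 = 0"
  by (simp add: mconst_def)

lemma mconst_1 [simp]: "mconst 1 = 1"
  by (simp add: mconst_def)

lemma mconst_power: "mconst (a ^ k) = mconst a ^ k"
  by (induction k) (simp_all add: mconst_mult)

lemma mconst_eq_0_iff [simp]: "mconst c = 0 \<longleftrightarrow> c = 0"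
  by (metis lookup_single_eq lookup_zero mconst_def mconst_0)

lemma lookup_mconst_mult: "Poly_Mapping.lookup (mconst c * p) e = c * Poly_Mapping.lookup p e"
  by (simp add: mconst_def map.rep_eq when_def flip: mult_map_scale_conv_mult)

text \<open>
  The extension \<open>Q R[T\<^sub>1, \<dots>, T\<^sub>n]\<close> of an ideal \<open>Q\<close> of \<open>R\<close>.
\<close>

definition coefficientwise :: "'a set \<Rightarrow> ('n, 'a::zero) mpolynomial set" where
  "coefficientwise Q = {p. \<forall>e. Poly_Mapping.lookup p e \<in> Q}"

lemma mconst_in_coefficientwise_iff:
  "0 \<in> Q \<Longrightarrow> mconst c \<in> coefficientwise Q \<longleftrightarrow> c \<in> Q"
  by (auto simp: coefficientwise_def mconst_def lookup_single when_def)

text \<open>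
  The index type carries no order, so exponent vectors are embedded additively into those indexed
  by the naturals, which are linearly ordered compatibly with addition. This amounts to the choice
  of a monomial order.
\<close>

lemma exponent_embedding:
  obtains \<nu> :: "('n::finite \<Rightarrow>\<^sub>0 nat) \<Rightarrow> (nat \<Rightarrow>\<^sub>0 nat)"
  where "inj \<nu>" "\<And>s t. \<nu> (s + t) = \<nu> s + \<nu> t"
proof
  let ?\<nu> = "\<lambda>e :: 'n \<Rightarrow>\<^sub>0 nat. \<Sum>i\<in>(UNIV::'n set). Poly_Mapping.single (to_nat i) (Poly_Mapping.lookup e i)"
  have "Poly_Mapping.lookup (?\<nu> e) (to_nat i) = Poly_Mapping.lookup e i" for e i
    by (simp add: lookup_sum lookup_single when_def)
  then show "inj ?\<nu>"
    by (intro inj_on_inverseI[where g = "\<lambda>d. Abs_poly_mapping (\<lambda>i. Poly_Mapping.lookup d (to_nat i))"]) simp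
  show "?\<nu> (s + t) = ?\<nu> s + ?\<nu> t" for s t
    by (simp add: lookup_add single_add sum.distrib)
qed

text \<open>
  Gauss' argument. If neither \<open>x\<close> nor \<open>y\<close> has all its coefficients in \<open>Q\<close>, let \<open>a\<close> and \<open>b\<close> be the
  largest exponents, for a monomial order, whose coefficients lie outside \<open>Q\<close>. Modulo \<open>Q\<close>, the
  coefficient of \<open>x * y\<close> at \<open>a + b\<close> is the product of these two coefficients, hence not in \<open>Q\<close>.
\<close>

lemma primeideal_coefficientwise:
  fixes Q :: "'a::comm_ring_1 set"
  assumes "primeideal Q ring_of_type_algebra"
  shows "primeideal (coefficientwise Q :: ('n::finite, 'a) mpolynomial set) ring_of_type_algebra"
proof -
  have Q: "0 \<in> Q" "\<And>x y. x \<in> Q \<Longrightarrow> y \<in> Q \<Longrightarrow> x + y \<in> Q" "\<And>r x. x \<in> Q \<Longrightarrow> r * x \<in> Q"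
    "1 \<notin> Q" "\<And>x y. x * y \<in> Q \<Longrightarrow> x \<in> Q \<or> y \<in> Q"
    using assms by (auto simp: primeideal_type_iff)
  have Q': "x * r \<in> Q" if "x \<in> Q" for r x
    using Q(3)[OF that] by (simp add: mult.commute)
  have sum_Q: "sum F A \<in> Q" if "\<And>i. i \<in> A \<Longrightarrow> F i \<in> Q" for F :: "'b \<Rightarrow> 'a" and A
    using that by (induction A rule: infinite_finite_induct) (auto intro: Q)
  have prime: "x \<in> coefficientwise Q \<or> y \<in> coefficientwise Q"
    if xy: "x * y \<in> coefficientwise Q" for x y :: "('n, 'a) mpolynomial"
  proof (rule ccontr)
    obtain \<nu> :: "('n \<Rightarrow>\<^sub>0 nat) \<Rightarrow> (nat \<Rightarrow>\<^sub>0 nat)"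
      where inj: "inj \<nu>" and hom: "\<And>s t. \<nu> (s + t) = \<nu> s + \<nu> t"
      using exponent_embedding by blast
    have top: "\<exists>a\<in>Poly_Mapping.keys z. Poly_Mapping.lookup z a \<notin> Q \<and>
        (\<forall>e. Poly_Mapping.lookup z e \<notin> Q \<longrightarrow> \<nu> e \<le> \<nu> a)"
      if "z \<notin> coefficientwise Q" for z
    proof -
      let ?N = "{e. Poly_Mapping.lookup z e \<notin> Q}"
      have "?N \<subseteq> Poly_Mapping.keys z" using Q(1) by (auto simp: in_keys_iff)
      moreover from this have "finite ?N" by (rule finite_subset) simp
      moreover have "?N \<noteq> {}" using that by (auto simp: coefficientwise_def)
      ultimately obtain a where "a \<in> ?N" "Max (\<nu> ` ?N) = \<nu> a"
        using Max_in[of "\<nu> ` ?N"] by blast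
      with \<open>?N \<subseteq> _\<close> Max_ge[OF finite_imageI[OF \<open>finite ?N\<close>, of \<nu>]] show ?thesis
        by (intro bexI[of _ a]) (auto simp del: in_keys_iff)
    qed
    assume "\<not> ?thesis"
    then obtain a b where
      a: "a \<in> Poly_Mapping.keys x" "Poly_Mapping.lookup x a \<notin> Q"
        "\<And>e. Poly_Mapping.lookup x e \<notin> Q \<Longrightarrow> \<nu> e \<le> \<nu> a" and
      b: "b \<in> Poly_Mapping.keys y" "Poly_Mapping.lookup y b \<notin> Q"
        "\<And>e. Poly_Mapping.lookup y e \<notin> Q \<Longrightarrow> \<nu> e \<le> \<nu> b"
      using top by meson
    let ?K = "Poly_Mapping.keys x \<times> Poly_Mapping.keys y"
    let ?F = "\<lambda>(s, t). Poly_Mapping.lookup x s * Poly_Mapping.lookup y t when a + b = s + t"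
    have rest: "sum ?F (?K - {(a, b)}) \<in> Q"
    proof (rule sum_Q)
      fix p assume "p \<in> ?K - {(a, b)}"
      then obtain s t where st: "p = (s, t)" "(s, t) \<noteq> (a, b)" by (cases p) blast
      have "(Poly_Mapping.lookup x s * Poly_Mapping.lookup y t when a + b = s + t) \<in> Q"
      proof (cases "a + b = s + t \<and> Poly_Mapping.lookup x s \<notin> Q \<and> Poly_Mapping.lookup y t \<notin> Q")
        case True
        then have "\<nu> s \<le> \<nu> a" "\<nu> t \<le> \<nu> b" "\<nu> a + \<nu> b = \<nu> s + \<nu> t"
          using a b by (auto simp flip: hom)
        then have "\<nu> s = \<nu> a" "\<nu> t = \<nu> b"
          by (metis add_le_cancel_left add_le_cancel_right order_antisym add_mono)+
        then have "s = a" "t = b" using inj by (auto dest: injD)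
        then show ?thesis using st by simp
      next
        case False
        then show ?thesis using Q(1,3) Q' by (auto simp: when_def)
      qed
      then show "?F p \<in> Q" by (simp add: st)
    qed
    have "Poly_Mapping.lookup (x * y) (a + b) = ?F (a, b) + sum ?F (?K - {(a, b)})"
      unfolding lookup_mult_sum using a b by (intro sum.remove) auto
    then have "Poly_Mapping.lookup x a * Poly_Mapping.lookup y b =
        Poly_Mapping.lookup (x * y) (a + b) + (- 1) * sum ?F (?K - {(a, b)})"
      by simp
    also have "\<dots> \<in> Q"
      using xy rest by (intro Q) (auto simp: coefficientwise_def)
    finally show False using Q(5) a b by blast
  qed
  show ?thesis
    unfolding primeideal_type_iff
  proof (intro conjI ballI allI impI)
    show "r * x \<in> coefficientwise Q" if "x \<in> coefficientwise Q" for r x :: "('n, 'a) mpolynomial"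
      using that unfolding coefficientwise_def
      by (auto simp: lookup_mult_sum case_prod_unfold when_def intro!: sum_Q Q)
    show "1 \<notin> (coefficientwise Q :: ('n, 'a) mpolynomial set)"
      using mconst_in_coefficientwise_iff[of Q 1] Q by simp
  qed (use Q prime in \<open>auto simp: coefficientwise_def lookup_add\<close>)
qed

text \<open>
  This is primality of the extension of the zero ideal.
\<close>

lemma mpolynomial_mult_eq_0_iff:
  fixes x y :: "('n::finite, 'a::idom) mpolynomial"
  shows "x * y = 0 \<longleftrightarrow> x = 0 \<or> y = 0"
proof -
  have "coefficientwise {0} = {0 :: ('n, 'a) mpolynomial}"
    by (auto simp: coefficientwise_def intro: poly_mapping_eqI)
  moreover have "primeideal {0::'a} ring_of_type_algebra"
    by (simp add: primeideal_type_iff)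
  ultimately show ?thesis
    using primeideal_coefficientwise[of "{0::'a}", where 'n = 'n]
    by (auto simp: primeideal_type_iff)
qed

section \<open>Division by the forcing polynomial\<close>

definition free_of :: "'n \<Rightarrow> ('n, 'a::zero) mpolynomial \<Rightarrow> bool" where
  "free_of i p \<longleftrightarrow> (\<forall>e\<in>Poly_Mapping.keys p. Poly_Mapping.lookup e i = 0)"

lemma free_of_mconst: "free_of i (mconst c)"
  by (auto simp: free_of_def mconst_def)

lemma free_of_mvar: "i \<noteq> j \<Longrightarrow> free_of i (mvar j :: ('n, 'a::zero_neq_one) mpolynomial)"
  by (auto simp: free_of_def mvar_def lookup_single)

lemma free_of_add: "free_of i p \<Longrightarrow> free_of i q \<Longrightarrow> free_of i (p + q)"
  using keys_add[of p q] by (auto simp: free_of_def)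

lemma free_of_mult:
  "free_of i p \<Longrightarrow> free_of i q \<Longrightarrow> free_of i (p * q)"
  using keys_mult[of p q] by (fastforce simp: free_of_def lookup_add)

lemma free_of_uminus: "free_of i p \<Longrightarrow> free_of i (- p)"
  for p :: "('n, 'a::ab_group_add) mpolynomial"
  by (auto simp: free_of_def in_keys_iff)

lemma free_of_sum: "(\<And>j. j \<in> A \<Longrightarrow> free_of i (F j)) \<Longrightarrow> free_of i (sum F A)"
  by (induction A rule: infinite_finite_induct)
    (auto simp: free_of_add free_of_def[of i 0])

lemma forcing_poly_split:
  obtains r where "forcing_poly f g = mconst (f i) * mvar i + r" "free_of i r"
proof
  let ?r = "(\<Sum>j\<in>UNIV - {i}. mconst (f j) * mvar j) + mconst g"
  show "forcing_poly f g = mconst (f i) * mvar i + ?r"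
    unfolding forcing_poly_def by (subst sum.remove[of _ i]) (auto simp: add.assoc)
  show "free_of i ?r"
    by (intro free_of_add free_of_sum free_of_mult free_of_mconst free_of_mvar) auto
qed

text \<open>
  The polynomials that admit such a division form a subring, as powers of \<open>f i\<close> can be multiplied
  up and remainders free of \<open>T\<^sub>i\<close> can be added and multiplied. It contains the constants and the
  variables other than \<open>T\<^sub>i\<close>, which are their own remainders, and \<open>T\<^sub>i\<close>, because
  \<open>f\<^sub>i T\<^sub>i = h - d\<close> with \<open>d\<close> free of \<open>T\<^sub>i\<close>.
\<close>

lemma forcing_pseudo_division:
  obtains k q r where "mconst (f i) ^ k * p = forcing_poly f g * q + r" "free_of i r"
proof -
  obtain d where d: "forcing_poly f g = mconst (f i) * mvar i + d" "free_of i d"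
    by (rule forcing_poly_split[of f g i])
  let ?h = "forcing_poly f g" and ?c = "mconst (f i)"
  have "\<exists>k q r. ?c ^ k * p = ?h * q + r \<and> free_of i r"
  proof (induction p rule: mpolynomial_induct)
    case (const c)
    show ?case by (intro exI[of _ 0] exI[of _ "mconst c"]) (simp add: free_of_mconst)
  next
    case (var j)
    show ?case
    proof (cases "j = i")
      case True
      then show ?thesis
        using d by (intro exI[of _ 1] exI[of _ "- d"]) (simp add: free_of_uminus)
    next
      case False
      then show ?thesis
        by (intro exI[of _ 0] exI[of _ "mvar j"]) (simp add: free_of_mvar)
    qed
  next
    case (add p p')
    then obtain k q r l q' r' where
      1: "?c ^ k * p = ?h * q + r" "free_of i r" and
      2: "?c ^ l * p' = ?h * q' + r'" "free_of i r'" by blast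
    have "?c ^ (k + l) * (p + p') = ?c ^ l * (?c ^ k * p) + ?c ^ k * (?c ^ l * p')"
      by (simp add: power_add algebra_simps)
    also have "\<dots> = ?h * (?c ^ l * q + ?c ^ k * q') + (?c ^ l * r + ?c ^ k * r')"
      unfolding 1(1) 2(1) by (simp add: algebra_simps)
    finally show ?case
      using 1(2) 2(2) by (metis free_of_add free_of_mult free_of_mconst mconst_power)
  next
    case (mult p p')
    then obtain k q r l q' r' where
      1: "?c ^ k * p = ?h * q + r" "free_of i r" and
      2: "?c ^ l * p' = ?h * q' + r'" "free_of i r'" by blast
    have "?c ^ (k + l) * (p * p') = (?c ^ k * p) * (?c ^ l * p')"
      by (simp add: power_add algebra_simps)
    also have "\<dots> = ?h * (q * (?c ^ l * p') + r * q') + r * r'"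
      unfolding 1(1) 2(1) by (simp add: algebra_simps)
    finally show ?case
      using 1(2) 2(2) by (metis free_of_mult)
  qed
  with that show ?thesis by blast
qed

text \<open>
  Multiplication by \<open>h\<close> raises the degree in \<open>T\<^sub>i\<close> by one: a monomial \<open>e\<close> of \<open>u\<close> of maximal degree in
  \<open>T\<^sub>i\<close> gives the monomial \<open>e T\<^sub>i\<close> of \<open>h * u\<close> with coefficient \<open>f i\<close> times that of \<open>e\<close>, since the
  part of \<open>h\<close> free of \<open>T\<^sub>i\<close> only contributes monomials of lower degree in \<open>T\<^sub>i\<close>.
\<close>

lemma free_of_forcing_multiple:
  fixes f :: "'n::finite \<Rightarrow> 'a::idom"
  assumes i: "f i \<noteq> 0" and free: "free_of i (forcing_poly f g * u)"
  shows "u = 0"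
proof (rule ccontr)
  assume "u \<noteq> 0"
  obtain d where d: "forcing_poly f g = mconst (f i) * mvar i + d" "free_of i d"
    by (rule forcing_poly_split[of f g i])
  let ?d = "\<lambda>e::'n \<Rightarrow>\<^sub>0 nat. Poly_Mapping.lookup e i"
  have ne: "?d ` Poly_Mapping.keys u \<noteq> {}" using \<open>u \<noteq> 0\<close> by simp
  have "Max (?d ` Poly_Mapping.keys u) \<in> ?d ` Poly_Mapping.keys u"
    using ne by (intro Max_in) simp_all
  then obtain e where e: "e \<in> Poly_Mapping.keys u" "Max (?d ` Poly_Mapping.keys u) = ?d e"
    by blast
  have max: "?d e' \<le> ?d e" if "e' \<in> Poly_Mapping.keys u" for e'
    using Max_ge[of "?d ` Poly_Mapping.keys u" "?d e'"] that by (simp add: e(2))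
  let ?s = "Poly_Mapping.single i (1::nat)"
  have "e + ?s = ?s + t \<longleftrightarrow> t = e" for t
    by (metis add.commute add_left_cancel)
  then have shift: "Poly_Mapping.lookup (mvar i * u) (e + ?s) = Poly_Mapping.lookup u e"
    using e(1)
    by (simp add: lookup_mult_sum mvar_def when_def flip: sum.cartesian_product)
  \<comment> \<open>The part of \<open>h\<close> free of \<open>T\<^sub>i\<close> cannot reach the degree of \<open>e + ?s\<close>, which exceeds all of \<open>u\<close>.\<close>
  have "e + ?s \<notin> Poly_Mapping.keys (d * u)"
  proof
    assume "e + ?s \<in> Poly_Mapping.keys (d * u)"
    then obtain s t where "e + ?s = s + t" "s \<in> Poly_Mapping.keys d" "t \<in> Poly_Mapping.keys u"
      using keys_mult[of d u] by blast
    moreover from this have "?d e + 1 = ?d s + ?d t"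
      by (metis lookup_add lookup_single_eq)
    ultimately show False using d(2) max[of t] by (auto simp: free_of_def)
  qed
  then have "Poly_Mapping.lookup (forcing_poly f g * u) (e + ?s) = f i * Poly_Mapping.lookup u e"
    by (simp add: d(1) distrib_right lookup_add mult.assoc lookup_mconst_mult shift in_keys_iff
        del: One_nat_def)
  then have "e + ?s \<in> Poly_Mapping.keys (forcing_poly f g * u)"
    using i e(1) by (simp add: in_keys_iff)
  then show False using free by (auto simp: free_of_def lookup_add)
qed

section \<open>The horizontal prime ideal\<close>

lemma lookup_to_fract_mpoly:
  "Poly_Mapping.lookup (to_fract_mpoly p) e = to_fract (Poly_Mapping.lookup p e)"
  by (simp add: to_fract_mpoly_def map.rep_eq when_def)

lemma to_fract_sum: "to_fract (sum F A) = (\<Sum>i\<in>A. to_fract (F i))"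
  by (induction A rule: infinite_finite_induct) simp_all

lemma to_fract_mpoly_add: "to_fract_mpoly (p + q) = to_fract_mpoly p + to_fract_mpoly q"
  by (intro poly_mapping_eqI) (simp add: lookup_to_fract_mpoly lookup_add)

lemma to_fract_mpoly_mult: "to_fract_mpoly (p * q) = to_fract_mpoly p * to_fract_mpoly q"
proof (rule poly_mapping_eqI)
  have keys: "Poly_Mapping.keys (to_fract_mpoly p) = Poly_Mapping.keys p" for p :: "('v, 'c::idom) mpolynomial"
    by (auto simp: in_keys_iff lookup_to_fract_mpoly)
  show "Poly_Mapping.lookup (to_fract_mpoly (p * q)) e =
      Poly_Mapping.lookup (to_fract_mpoly p * to_fract_mpoly q) e" for e
    unfolding lookup_mult_sum lookup_to_fract_mpoly to_fract_sum keys
    by (rule sum.cong) (auto simp: when_def)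
qed

lemma to_fract_mpoly_mconst: "to_fract_mpoly (mconst c) = mconst (to_fract c)"
  by (intro poly_mapping_eqI) (simp add: lookup_to_fract_mpoly mconst_def lookup_single when_def)

lemma to_fract_mpoly_mvar: "to_fract_mpoly (mvar i) = mvar i"
  by (intro poly_mapping_eqI) (simp add: lookup_to_fract_mpoly mvar_def lookup_single when_def)

lemma to_fract_mpoly_eq_iff: "to_fract_mpoly p = to_fract_mpoly q \<longleftrightarrow> p = q"
  by (simp add: poly_mapping_eq_iff fun_eq_iff lookup_to_fract_mpoly)

lemma clear_denominators:
  fixes v :: "('n, 'a::idom fract) mpolynomial"
  obtains c u where "c \<noteq> 0" "mconst (to_fract c) * v = to_fract_mpoly u"
proof -
  have "\<exists>c u. c \<noteq> 0 \<and> mconst (to_fract c) * v = to_fract_mpoly u"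
  proof (induction v rule: mpolynomial_induct)
    case (const d)
    obtain a b where "d = Fract a b" "b \<noteq> 0" by (cases d) auto
    then have "mconst (to_fract b) * mconst d = to_fract_mpoly (mconst a)"
      by (simp add: Fract_conv_to_fract to_fract_mpoly_mconst flip: mconst_mult)
    with \<open>b \<noteq> 0\<close> show ?case by blast
  next
    case (var i)
    show ?case by (intro exI[of _ 1] exI[of _ "mvar i"]) (simp add: to_fract_mpoly_mvar)
  next
    case (add v w)
    then obtain c u d t where
      c: "c \<noteq> 0" "mconst (to_fract c) * v = to_fract_mpoly u" and
      d: "d \<noteq> 0" "mconst (to_fract d) * w = to_fract_mpoly t" by blast
    have "mconst (to_fract (c * d)) * (v + w) =
        mconst (to_fract d) * (mconst (to_fract c) * v) + mconst (to_fract c) * (mconst (to_fract d) * w)"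
      by (simp add: mconst_mult algebra_simps)
    also have "\<dots> = to_fract_mpoly (mconst d * u + mconst c * t)"
      by (simp add: c d to_fract_mpoly_add to_fract_mpoly_mult to_fract_mpoly_mconst)
    finally show ?case using c(1) d(1) by (metis mult_eq_0_iff)
  next
    case (mult v w)
    then obtain c u d t where
      c: "c \<noteq> 0" "mconst (to_fract c) * v = to_fract_mpoly u" and
      d: "d \<noteq> 0" "mconst (to_fract d) * w = to_fract_mpoly t" by blast
    have "mconst (to_fract (c * d)) * (v * w) =
        (mconst (to_fract c) * v) * (mconst (to_fract d) * w)"
      by (simp add: mconst_mult algebra_simps)
    also have "\<dots> = to_fract_mpoly (u * t)"
      by (simp add: c d to_fract_mpoly_mult)
    finally show ?case using c(1) d(1) by (metis mult_eq_0_iff)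
  qed
  with that show ?thesis by blast
qed

text \<open>
  Clearing denominators describes the contraction from the quotient field without leaving the
  polynomial ring: the horizontal ideal is the \<open>R\<close>-torsion modulo \<open>h\<close>.
\<close>

lemma horizontal_ideal_iff:
  fixes f :: "'n::finite \<Rightarrow> 'a::idom"
  shows
  "p \<in> horizontal_ideal f g \<longleftrightarrow> (\<exists>c u. c \<noteq> 0 \<and> mconst c * p = forcing_poly f g * u)"
proof -
  let ?h = "forcing_poly f g"
  have "p \<in> horizontal_ideal f g \<longleftrightarrow> (\<exists>v. to_fract_mpoly p = v * to_fract_mpoly ?h)"
    by (simp add: horizontal_ideal_def cgenideal_def ring_of_type_algebra_def)
  also have "\<dots> \<longleftrightarrow> (\<exists>c u. c \<noteq> 0 \<and> mconst c * p = ?h * u)"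
  proof
    assume "\<exists>v. to_fract_mpoly p = v * to_fract_mpoly ?h"
    then obtain v where v: "to_fract_mpoly p = v * to_fract_mpoly ?h" ..
    obtain c u where c: "c \<noteq> 0" and u: "mconst (to_fract c) * v = to_fract_mpoly u"
      by (rule clear_denominators)
    have "to_fract_mpoly (mconst c * p) = mconst (to_fract c) * v * to_fract_mpoly ?h"
      by (simp add: to_fract_mpoly_mult to_fract_mpoly_mconst v mult.assoc)
    also have "\<dots> = to_fract_mpoly (?h * u)"
      unfolding u by (simp add: to_fract_mpoly_mult mult.commute)
    finally show "\<exists>c u. c \<noteq> 0 \<and> mconst c * p = ?h * u"
      using c by (auto simp: to_fract_mpoly_eq_iff)
  next
    assume "\<exists>c u. c \<noteq> 0 \<and> mconst c * p = ?h * u"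
    then obtain c u where c: "c \<noteq> 0" and u: "mconst c * p = ?h * u" by blast
    have "mconst (inverse (to_fract c)) * mconst (to_fract c) = (1 :: ('n, 'a fract) mpolynomial)"
      using c by (simp flip: mconst_mult)
    then have "to_fract_mpoly p = mconst (inverse (to_fract c)) * to_fract_mpoly (mconst c * p)"
      by (simp add: to_fract_mpoly_mult to_fract_mpoly_mconst flip: mult.assoc)
    also have "\<dots> = (mconst (inverse (to_fract c)) * to_fract_mpoly u) * to_fract_mpoly ?h"
      unfolding u by (simp add: to_fract_mpoly_mult mult_ac)
    finally show "\<exists>v. to_fract_mpoly p = v * to_fract_mpoly ?h" ..
  qed
  finally show ?thesis .
qed

text \<open>
  Any nonzero \<open>f i\<close> suffices to annihilate this torsion: if \<open>c p \<in> (h)\<close> and \<open>r\<close> is the remainder of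
  \<open>p\<close>, then \<open>c r\<close> is a multiple of \<open>h\<close> free of \<open>T\<^sub>i\<close>, hence zero. So after inverting \<open>f i\<close> the
  horizontal ideal is generated by \<open>h\<close>.
\<close>

lemma horizontal_ideal_torsion:
  fixes f :: "'n::finite \<Rightarrow> 'a::idom"
  assumes i: "f i \<noteq> 0" and p: "p \<in> horizontal_ideal f g"
  obtains k u where "mconst (f i) ^ k * p = forcing_poly f g * u"
proof -
  let ?h = "forcing_poly f g"
  obtain c u where c: "c \<noteq> 0" and u: "mconst c * p = ?h * u"
    using p by (auto simp: horizontal_ideal_iff)
  obtain k q r where div: "mconst (f i) ^ k * p = ?h * q + r" and r: "free_of i r"
    by (rule forcing_pseudo_division[where f = f and g = g and i = i])
  have "mconst c * r = mconst c * (mconst (f i) ^ k * p - ?h * q)"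
    by (simp add: div)
  also have "\<dots> = mconst (f i) ^ k * (mconst c * p) - ?h * (mconst c * q)"
    by (simp add: algebra_simps)
  also have "\<dots> = ?h * (mconst (f i) ^ k * u - mconst c * q)"
    unfolding u by (simp add: algebra_simps)
  finally have eq: "mconst c * r = ?h * (mconst (f i) ^ k * u - mconst c * q)" .
  have "free_of i (mconst c * r)"
    by (intro free_of_mult free_of_mconst r)
  then have "mconst (f i) ^ k * u - mconst c * q = 0"
    unfolding eq by (rule free_of_forcing_multiple[of f i g, OF i])
  then have "r = 0" using c eq by (simp add: mpolynomial_mult_eq_0_iff)
  with div that show ?thesis by simp
qed

text \<open>
  A polynomial lies in the horizontal ideal if and only if its remainder on division by \<open>h\<close> is
  zero. Remainders multiply, so primality is the absence of zero divisors among polynomials.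
\<close>

lemma primeideal_horizontal:
  fixes f :: "'n::finite \<Rightarrow> 'a::idom"
  assumes i: "f i \<noteq> 0"
  shows "primeideal (horizontal_ideal f g) ring_of_type_algebra"
proof -
  let ?h = "forcing_poly f g" and ?H = "horizontal_ideal f g"
  have one: "1 \<notin> ?H"
  proof
    assume "1 \<in> ?H"
    then obtain c u where c: "c \<noteq> 0" "mconst c = ?h * u" by (auto simp: horizontal_ideal_iff)
    then have "u = 0" using free_of_forcing_multiple[of f i g, OF i] free_of_mconst by metis
    with c show False by simp
  qed
  have free: "r = 0" if r: "free_of i r" "r \<in> ?H" for r
  proof -
    obtain k u where u: "mconst (f i) ^ k * r = ?h * u"
      using horizontal_ideal_torsion[of f i, OF i r(2)] .
    moreover have "free_of i (mconst (f i) ^ k * r)"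
      using r(1) by (metis free_of_mult free_of_mconst mconst_power)
    ultimately have "u = 0" using free_of_forcing_multiple[of f i g, OF i] by metis
    with u have "mconst (f i ^ k) * r = 0" by (simp add: mconst_power)
    with i show ?thesis by (simp add: mpolynomial_mult_eq_0_iff)
  qed
  show ?thesis
    unfolding primeideal_type_iff
  proof (intro conjI ballI allI impI)
    show "0 \<in> ?H"
      unfolding horizontal_ideal_iff by (intro exI[of _ 1] exI[of _ 0]) simp
    show add: "x + y \<in> ?H" if "x \<in> ?H" "y \<in> ?H" for x y
    proof -
      from that obtain c u d v where c: "c \<noteq> 0" "mconst c * x = ?h * u"
        and d: "d \<noteq> 0" "mconst d * y = ?h * v" by (auto simp: horizontal_ideal_iff)
      have "mconst (c * d) * (x + y) = mconst d * (mconst c * x) + mconst c * (mconst d * y)"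
        by (simp add: mconst_mult algebra_simps)
      also have "\<dots> = ?h * (mconst d * u + mconst c * v)"
        unfolding c d by (simp add: algebra_simps)
      finally show ?thesis
        using c(1) d(1) unfolding horizontal_ideal_iff by (metis mult_eq_0_iff)
    qed
    show mult: "r * x \<in> ?H" if "x \<in> ?H" for r x
      using that unfolding horizontal_ideal_iff by (metis mult.left_commute)
    show "1 \<notin> ?H" by (rule one)
    show "x \<in> ?H \<or> y \<in> ?H" if xy: "x * y \<in> ?H" for x y
    proof -
      obtain k q r where 1: "mconst (f i) ^ k * x = ?h * q + r" "free_of i r"
        by (rule forcing_pseudo_division[where f = f and g = g and i = i])
      obtain l q' r' where 2: "mconst (f i) ^ l * y = ?h * q' + r'" "free_of i r'"
        by (rule forcing_pseudo_division[where f = f and g = g and i = i])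
      have rem: "z \<in> ?H" if "mconst (f i) ^ m * z = ?h * s" for m z s
        using that i unfolding horizontal_ideal_iff
        by (intro exI[of _ "f i ^ m"] exI[of _ s]) (simp add: mconst_power)
      \<comment> \<open>The product of the remainders differs from a multiple of \<open>x * y\<close> by a multiple of \<open>h\<close>.\<close>
      have "r * r' = (mconst (f i) ^ k * x - ?h * q) * (mconst (f i) ^ l * y - ?h * q')"
        by (simp add: 1 2)
      also have "\<dots> = mconst (f i) ^ k * mconst (f i) ^ l * (x * y) +
          (q * q' * ?h - q * mconst (f i) ^ l * y - q' * mconst (f i) ^ k * x) * ?h"
        by (simp add: algebra_simps)
      also have "\<dots> \<in> ?H"
        using rem[of 0 ?h 1] by (intro add mult xy) simp
      finally have "r * r' = 0" by (intro free free_of_mult 1 2)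
      then have "r = 0 \<or> r' = 0" by (simp add: mpolynomial_mult_eq_0_iff)
      then show ?thesis using rem[of k x q] rem[of l y q'] 1 2 by auto
    qed
  qed
qed

section \<open>The two pieces of the spectrum\<close>

lemma mpolynomial_eq_sum_monomials:
  "p = (\<Sum>e\<in>Poly_Mapping.keys p. mconst (Poly_Mapping.lookup p e) * Poly_Mapping.single e 1)"
  for p :: "('n, 'a::comm_ring_1) mpolynomial"
  by (rule poly_mapping_eqI)
    (simp add: lookup_sum mconst_def mult_single lookup_single when_def in_keys_iff)

text \<open>
  A prime \<open>Q\<close> of the polynomial ring above \<open>S\<close> contains the extension of its contraction \<open>q\<close> to \<open>R\<close>.
  Hence the locus is the union of the irreducible sets \<open>V(q R[T\<^sub>1, \<dots>, T\<^sub>n])\<close>, for \<open>q\<close> a prime above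
  \<open>S\<close>. As \<open>R\<close> is local, \<open>q \<subseteq> \<mm>\<close>, so all of them share the point \<open>\<mm> R[T\<^sub>1, \<dots>, T\<^sub>n]\<close>.
\<close>

lemma connectedin_locus_of_constants:
  fixes \<mm> S :: "'a::comm_ring_1 set"
  assumes loc: "local_ring ring_of_type_algebra \<mm>" and S: "S \<subseteq> \<mm>"
  defines "P \<equiv> (ring_of_type_algebra :: ('n::finite, 'a) mpolynomial ring)"
  shows "coefficientwise \<mm> \<in> vanishing_locus P (mconst ` S)"
    and "connectedin (zariski_topology P) (vanishing_locus P (mconst ` S))"
proof -
  let ?R = "ring_of_type_algebra :: 'a ring" and ?V = "vanishing_locus P (mconst ` S)"
  interpret R: cring ?R by (rule cring_from_type_algebra)
  have max: "maximalideal \<mm> ?R" "\<And>M. maximalideal M ?R \<Longrightarrow> M = \<mm>"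
    using loc by (auto simp: local_ring_def)
  define F where "F = {q. primeideal q ?R \<and> S \<subseteq> q}"
  have m: "\<mm> \<in> F" using S R.maximalideal_prime[OF max(1)] by (simp add: F_def)
  have le_m: "q \<subseteq> \<mm>" if "q \<in> F" for q
  proof -
    have q: "primeideal q ?R" using that by (simp add: F_def)
    have "1 \<notin> q" using q by (simp add: primeideal_type_iff)
    then obtain M where "maximalideal M ?R" "q \<subseteq> M"
      using R.exists_maximalideal_above[OF primeideal.axioms(1)[OF q]]
      by (auto simp: ring_of_type_algebra_def)
    with max show ?thesis by blast
  qed
  have co: "coefficientwise q \<in> prime_spectrum P" if "q \<in> F" for q
    using that primeideal_coefficientwise[of q] by (auto simp: F_def P_def prime_spectrum_def)
  have mono: "coefficientwise q \<subseteq> coefficientwise q'" if "q \<subseteq> q'" for q q' :: "'a set"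
    using that by (auto simp: coefficientwise_def)
  have constants: "mconst ` S \<subseteq> coefficientwise q" if "q \<in> F" for q
    using that by (auto simp: F_def mconst_in_coefficientwise_iff primeideal_type_iff)
  show "coefficientwise \<mm> \<in> ?V"
    using co[OF m] constants[OF m] by (auto simp: vanishing_locus_def)
  have V: "?V = (\<Union>q\<in>F. vanishing_locus P (coefficientwise q))"
  proof (intro Set.equalityI subsetI)
    fix Q assume "Q \<in> (\<Union>q\<in>F. vanishing_locus P (coefficientwise q))"
    then show "Q \<in> ?V" using constants by (fastforce simp: vanishing_locus_def)
  next
    fix Q assume "Q \<in> ?V"
    then have Q: "primeideal Q P" "mconst ` S \<subseteq> Q"
      by (auto simp: vanishing_locus_def prime_spectrum_def)
    note Q' = Q(1)[unfolded P_def primeideal_type_iff]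
    let ?q = "{c. mconst c \<in> Q}"
    have "primeideal ?q ?R"
      using Q' unfolding primeideal_type_iff by (simp add: mconst_add mconst_mult)
    then have "?q \<in> F" using Q(2) by (auto simp: F_def)
    moreover have "coefficientwise ?q \<subseteq> Q"
    proof
      fix p :: "('n, 'a) mpolynomial" assume p: "p \<in> coefficientwise ?q"
      have sum_Q: "sum G A \<in> Q" if "\<And>i. i \<in> A \<Longrightarrow> G i \<in> Q"
        for G :: "('n \<Rightarrow>\<^sub>0 nat) \<Rightarrow> ('n, 'a) mpolynomial" and A
        using that Q' by (induction A rule: infinite_finite_induct) auto
      show "p \<in> Q"
        using p Q' by (subst mpolynomial_eq_sum_monomials, intro sum_Q)
          (simp add: coefficientwise_def mult.commute[of "mconst _"])
    qed
    ultimately show "Q \<in> (\<Union>q\<in>F. vanishing_locus P (coefficientwise q))"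
      using Q(1) by (auto simp: vanishing_locus_def prime_spectrum_def)
  qed
  show "connectedin (zariski_topology P) ?V"
    unfolding V
  proof (rule connectedin_Union)
    show "connectedin (zariski_topology P) W"
      if "W \<in> (\<lambda>q. vanishing_locus P (coefficientwise q)) ` F" for W
      using that connectedin_vanishing_locus_prime[OF co] by blast
    have "coefficientwise \<mm> \<in> \<Inter> ((\<lambda>q. vanishing_locus P (coefficientwise q)) ` F)"
      using co[OF m] mono[OF le_m] by (auto simp: vanishing_locus_def)
    then show "\<Inter> ((\<lambda>q. vanishing_locus P (coefficientwise q)) ` F) \<noteq> {}" by blast
  qed
qed

text \<open>
  Let \<open>Q\<close> be a prime containing \<open>h\<close>. If some \<open>f j\<close> is not in \<open>Q\<close>, then every element of the
  horizontal ideal is moved into \<open>(h) \<subseteq> Q\<close> by a power of \<open>f j\<close>, hence lies in \<open>Q\<close> itself. If all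
  \<open>f j\<close> are in \<open>Q\<close>, then so is \<open>g = h - (\<Sum>j. f\<^sub>j T\<^sub>j)\<close>.
\<close>

lemma forcing_locus_decomposition:
  fixes f :: "'n::finite \<Rightarrow> 'a::idom"
  assumes i: "f i \<noteq> 0"
  defines "P \<equiv> (ring_of_type_algebra :: ('n, 'a) mpolynomial ring)"
  shows "vanishing_locus P (PIdl\<^bsub>P\<^esub> (forcing_poly f g)) =
         vanishing_locus P (horizontal_ideal f g) \<union> vanishing_locus P (mconst ` insert g (range f))"
proof -
  let ?h = "forcing_poly f g" and ?H = "horizontal_ideal f g" and ?S = "mconst ` insert g (range f)"
  have "PIdl\<^bsub>P\<^esub> ?h \<subseteq> Q \<longleftrightarrow> ?H \<subseteq> Q \<or> ?S \<subseteq> Q" if "primeideal Q P" for Q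
  proof -
    note Q = that[unfolded P_def primeideal_type_iff]
    have sum_Q: "sum G A \<in> Q" if "\<And>j. j \<in> A \<Longrightarrow> G j \<in> Q"
      for G :: "'n \<Rightarrow> ('n, 'a) mpolynomial" and A
      using that Q by (induction A rule: infinite_finite_induct) auto
    have pidl: "PIdl\<^bsub>P\<^esub> ?h \<subseteq> Q \<longleftrightarrow> ?h \<in> Q"
    proof
      have "1 * ?h \<in> PIdl\<^bsub>P\<^esub> ?h"
        unfolding cgenideal_def P_def ring_of_type_algebra_def by (auto intro: exI[of _ 1])
      then show "?h \<in> Q" if "PIdl\<^bsub>P\<^esub> ?h \<subseteq> Q" using that by auto
      show "PIdl\<^bsub>P\<^esub> ?h \<subseteq> Q" if "?h \<in> Q"
        using that Q unfolding cgenideal_def P_def ring_of_type_algebra_def by auto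
    qed
    have linear: "(\<Sum>j\<in>UNIV. mconst (f j) * mvar j) \<in> Q" if "\<And>j. mconst (f j) \<in> Q"
      using that Q by (intro sum_Q) (simp add: mult.commute[of "mconst _"])
    show ?thesis
      unfolding pidl
    proof
      assume h: "?h \<in> Q"
      show "?H \<subseteq> Q \<or> ?S \<subseteq> Q"
      proof (cases "\<exists>j. mconst (f j) \<notin> Q")
        case True
        then obtain j where j: "mconst (f j) \<notin> Q" ..
        then have "f j \<noteq> 0" using Q by auto
        have power: "mconst (f j) ^ k \<notin> Q" for k
          using Q j by (induction k) auto
        have "p \<in> Q" if p: "p \<in> ?H" for p
        proof -
          obtain k u where "mconst (f j) ^ k * p = ?h * u"
            using horizontal_ideal_torsion[of f j, OF \<open>f j \<noteq> 0\<close> p] .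
          moreover have "?h * u \<in> Q" using h Q by (metis mult.commute)
          ultimately show ?thesis using power Q by metis
        qed
        then show ?thesis by blast
      next
        case False
        have "mconst g = ?h + (- 1) * (\<Sum>j\<in>UNIV. mconst (f j) * mvar j)"
          by (simp add: forcing_poly_def)
        also have "\<dots> \<in> Q" using h Q linear False by blast
        finally show ?thesis using False by auto
      qed
    next
      assume "?H \<subseteq> Q \<or> ?S \<subseteq> Q"
      moreover have "?h \<in> ?H"
        unfolding horizontal_ideal_iff by (intro exI[of _ 1]) simp
      moreover have "?h \<in> Q" if "?S \<subseteq> Q"
        using that Q linear unfolding forcing_poly_def by auto
      ultimately show "?h \<in> Q" by blast
    qed
  qed
  then show ?thesis unfolding vanishing_locus_def prime_spectrum_def by blast
qed

theorem corollary3p3: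
  fixes R :: "'a::idom ring"
    and P :: "('n::finite, 'a) mpolynomial ring"
    and \<mm> I :: "'a set"
    and f :: "'n \<Rightarrow> 'a"
    and g :: 'a
  assumes "R = ring_of_type_algebra"
    and "P = ring_of_type_algebra"
    and "noetherian_ring R"
    and "local_ring R \<mm>"
    and "I = Idl\<^bsub>R\<^esub> (range f)"
    and "I \<subseteq> \<mm>"
    and "I \<noteq> {0}"
    and "g \<in> \<mm>"
  shows "spectrum_connected (forcing_algebra f g) \<longleftrightarrow>
         horizontal_ideal f g <+>\<^bsub>P\<^esub> Idl\<^bsub>P\<^esub> (mconst ` insert g (range f)) \<noteq> Idl\<^bsub>P\<^esub> {1}"
proof -
  let ?S = "mconst ` insert g (range f)" and ?H = "horizontal_ideal f g"
  let ?VH = "vanishing_locus P ?H" and ?VS = "vanishing_locus P ?S"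
  let ?X = "zariski_topology P" and ?J = "PIdl\<^bsub>P\<^esub> (forcing_poly f g)"
  interpret R: cring R unfolding assms(1) by (rule cring_from_type_algebra)
  interpret P: cring P unfolding assms(2) by (rule cring_from_type_algebra)
  have carrier: "carrier R = UNIV" "carrier P = UNIV" "\<zero>\<^bsub>R\<^esub> = 0" "\<one>\<^bsub>P\<^esub> = 1"
    by (simp_all add: assms(1,2) ring_of_type_algebra_def)
  have "range f \<subseteq> I" unfolding assms(5) by (rule R.genideal_self) (simp add: carrier)
  then have S_m: "insert g (range f) \<subseteq> \<mm>" using assms(6,8) by blast
  have "\<exists>i. f i \<noteq> 0"
  proof (rule ccontr)
    assume "\<not> ?thesis"
    then have "range f = {0}" by auto
    then show False using assms(5,7) R.genideal_zero by (simp add: carrier)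
  qed
  then obtain i where i: "f i \<noteq> 0" ..
  have H: "primeideal ?H P" unfolding assms(2) by (rule primeideal_horizontal[of f i, OF i])
  have J: "ideal ?J P"
    by (simp add: P.cgenideal_ideal carrier)
  have decomp: "vanishing_locus P ?J = ?VH \<union> ?VS"
    unfolding assms(2) by (rule forcing_locus_decomposition[of f i, OF i])
  have VH: "?H \<in> ?VH" "connectedin ?X ?VH"
    using H connectedin_vanishing_locus_prime[of ?H P]
    by (auto simp: vanishing_locus_def prime_spectrum_def)
  have VS: "?VS \<noteq> {}" "connectedin ?X ?VS"
    using connectedin_locus_of_constants[OF assms(4)[unfolded assms(1)] S_m, where 'n = 'n]
    unfolding assms(2) by blast+
  have "closedin ?X ?VH" "closedin ?X ?VS"
    by (rule closedin_vanishing_locus, simp add: carrier)+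
  then have disconnected: "\<not> connectedin ?X (?VH \<union> ?VS)" if "?VH \<inter> ?VS = {}"
    using that VH(1) VS(1) unfolding connectedin_closedin by blast
  have "spectrum_connected (forcing_algebra f g) \<longleftrightarrow> connectedin ?X (?VH \<union> ?VS)"
    using P.spectrum_connected_Quot_iff[OF J] VH(1)
    unfolding forcing_algebra_def assms(2)[symmetric] decomp by blast
  also have "\<dots> \<longleftrightarrow> ?VH \<inter> ?VS \<noteq> {}"
    using disconnected connectedin_Un[OF VH(2) VS(2)] by blast
  also have "?VH \<inter> ?VS = vanishing_locus P (?H <+>\<^bsub>P\<^esub> Idl\<^bsub>P\<^esub> ?S)"
  proof -
    have "?H <+>\<^bsub>P\<^esub> Idl\<^bsub>P\<^esub> ?S \<subseteq> Q \<longleftrightarrow> ?H \<subseteq> Q \<and> ?S \<subseteq> Q" if "primeideal Q P" for Q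
    proof -
      have Q: "ideal Q P" using that by (rule primeideal.axioms)
      have "?H <+>\<^bsub>P\<^esub> Idl\<^bsub>P\<^esub> ?S = Idl\<^bsub>P\<^esub> (?H \<union> Idl\<^bsub>P\<^esub> ?S)"
        using P.union_genideal[OF primeideal.axioms(1)[OF H] P.genideal_ideal[of ?S]]
        by (simp add: carrier)
      then show ?thesis
        using P.Idl_subset_ideal[OF Q] by (simp add: carrier)
    qed
    then show ?thesis unfolding vanishing_locus_def prime_spectrum_def by blast
  qed
  also have "\<dots> \<noteq> {} \<longleftrightarrow> 1 \<notin> ?H <+>\<^bsub>P\<^esub> Idl\<^bsub>P\<^esub> ?S"
    using P.vanishing_locus_nonempty_iff[OF P.add_ideals[OF primeideal.axioms(1)[OF H]
          P.genideal_ideal[of ?S]]]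
    by (simp add: carrier)
  also have "\<dots> \<longleftrightarrow> ?H <+>\<^bsub>P\<^esub> Idl\<^bsub>P\<^esub> ?S \<noteq> Idl\<^bsub>P\<^esub> {1}"
    using ideal.one_imp_carrier[OF P.add_ideals[OF primeideal.axioms(1)[OF H]
          P.genideal_ideal[of ?S]]] P.genideal_one
    by (auto simp: carrier)
  finally show ?thesis .
qed

end
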